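(* Let $\lambda=(\lambda_1\ge\dots\ge\lambda_n)\in\mathbb R^n$ be a dominant weight of $GL_n$ and $\ell=\frac1n\sum_i\lambda_i$. Then there is a bijective correspondence $$\left\{\begin{array}{c}\text{solutions to the tropical critical}\\ \text{conditions with highest weight }\lambda\end{array}\right\}\longleftrightarrow\left\{\begin{array}{c}\text{ideal fillings }\{n_{ij}\}_{1\le i<j\le n}\text{ for }\lambda,\\ \text{i.e. such that }\sum n_{ij}\alpha_{ij}+\ell\sum\epsilon_i=\lambda\end{array}\right\}.$$
   Context: Quiver. The vertices are $v_{ij}$, $1\le j\le i\le n$ (arranged like lower triangular matrix entries). The vertices $v_{ii}$ are star vertices; $\mathcal V^\bullet=\{v_{ij}\mid 1\le j<i\le n\}$ are the dot vertices. The arrows are the vertical arrows $a_{ij}:v_{i+1,j}\to v_{ij}$ ($1\le j\le i\le n-1$) and the horizontal arrows $b_{ij}:v_{ij}\to v_{i,j-1}$ ($2\le j\le i\le n$). For an arrow $a$, $h(a)$ is its head and $t(a)$ its tail. Tropical critical conditions. A solution to the tropical critical conditions with highest weight $\lambda$ is an assignment of real numbers $\delta_v$ to all vertices $v$ with $\delta_{v_{ii}}=\lambda_i$ for $i=1,\dots,n$, such that, with tropical arrow coordinates $\rho_a=\delta_{h(a)}-\delta_{t(a)}$, $$\min_{a:h(a)=v}\{\rho_a\}=\min_{a:t(a)=v}\{\rho_a\}\quad\text{for all }v\in\mathcal V^\bullet.$$ (Given $\lambda$, the $\delta_v$ and the $\rho_a$ determine each other.) Ideal fillings. A filling is a collection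 $\{n_{ij}\}_{1\le i<j\le n}$ of non-negative reals; it is ideal if $n_{ij}=\max\{n_{i+1,j},n_{i,j-1}\}$ for $j-i\ge2$. It is an ideal filling for $\lambda$ if it is ideal and $\sum_{i<j}n_{ij}\alpha_{ij}+\ell\sum_i\epsilon_i=\lambda$, where $\epsilon_i$ is the standard basis of $\mathbb R^n$ and $\alpha_{ij}=\epsilon_i-\epsilon_j$. *)

theory Defs
  imports Complex_Main "HOL-Library.FuncSet" "Graph_Theory.Digraph"
begin

text \<open>
  The pair \<open>(i, j)\<close> stands for the vertex $v_{ij}$ (row $i$, column $j$). \<open>Vert i j\<close> is the
  vertical arrow $a_{ij} : v_{i+1,j} \to v_{ij}$ and \<open>Horiz i j\<close> the horizontal arrow
  $b_{ij} : v_{ij} \to v_{i,j-1}$.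
\<close>

datatype arrow = Vert nat nat | Horiz nat nat

fun arrow_tail :: "arrow \<Rightarrow> nat \<times> nat" where
  "arrow_tail (Vert i j) = (i + 1, j)"
| "arrow_tail (Horiz i j) = (i, j)"

fun arrow_head :: "arrow \<Rightarrow> nat \<times> nat" where
  "arrow_head (Vert i j) = (i, j)"
| "arrow_head (Horiz i j) = (i, j - 1)"

definition quiver :: "nat \<Rightarrow> (nat \<times> nat, arrow) pre_digraph" where
  "quiver n =
    \<lparr> verts = {(i, j). 1 \<le> j \<and> j \<le> i \<and> i \<le> n},
      arcs = {Vert i j |i j. 1 \<le> j \<and> j \<le> i \<and> i \<le> n - 1}
           \<union> {Horiz i j |i j. 2 \<le> j \<and> j \<le> i \<and> i \<le> n},
      tail = arrow_tail,
      head = arrow_head \<rparr>"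

definition dot_verts :: "nat \<Rightarrow> (nat \<times> nat) set" where
  "dot_verts n = {(i, j). 1 \<le> j \<and> j < i \<and> i \<le> n}"

definition tropical_coord :: "nat \<Rightarrow> (nat \<times> nat \<Rightarrow> real) \<Rightarrow> arrow \<Rightarrow> real" where
  "tropical_coord n \<delta> a = \<delta> (head (quiver n) a) - \<delta> (tail (quiver n) a)"

lemma fin_digraph_quiver: "fin_digraph (quiver n)"
proof
  fix a assume "a \<in> arcs (quiver n)"
  then show "tail (quiver n) a \<in> verts (quiver n)" and "head (quiver n) a \<in> verts (quiver n)"
    by (auto simp: quiver_def)
next
  have "verts (quiver n) \<subseteq> {..n} \<times> {..n}"
    by (auto simp: quiver_def)
  then show "finite (verts (quiver n))"
    by (rule finite_subset) simp
next
  have "arcs (quiver n) \<subseteq> case_prod Vert ` ({..n} \<times> {..n}) \<union> case_prod Horiz ` ({..n} \<times> {..n})"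
    by (force simp: quiver_def)
  then show "finite (arcs (quiver n))"
    by (rule finite_subset) simp
qed

text \<open>
  At a dot vertex neither minimum of the critical conditions is taken over the empty set.
\<close>

lemma dot_vert_arcs_nonempty:
  assumes "v \<in> dot_verts n"
  shows "in_arcs (quiver n) v \<noteq> {}" and "out_arcs (quiver n) v \<noteq> {}"
proof -
  obtain i j where v: "v = (i, j)" "1 \<le> j" "j < i" "i \<le> n"
    using assms by (auto simp: dot_verts_def)
  have "Horiz i (j + 1) \<in> in_arcs (quiver n) v"
    using v by (auto simp: in_arcs_def quiver_def)
  moreover have "Vert (i - 1) j \<in> out_arcs (quiver n) v"
    using v by (auto simp: out_arcs_def quiver_def)
  ultimately show "in_arcs (quiver n) v \<noteq> {}" and "out_arcs (quiver n) v \<noteq> {}"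
    by blast+
qed

text \<open>
  Weights are given by their coordinates \<open>\<lambda> 1, \<dots>, \<lambda> n\<close>; values at other indices are irrelevant.
\<close>

definition dominant :: "nat \<Rightarrow> (nat \<Rightarrow> real) \<Rightarrow> bool" where
  "dominant n lam \<longleftrightarrow> (\<forall>i\<in>{1..n}. \<forall>j\<in>{1..n}. i \<le> j \<longrightarrow> lam j \<le> lam i)"

text \<open>
  Families indexed by vertices or by pairs $i < j$ are extensional functions, so that two of them
  are equal as soon as they agree on the index set.
\<close>

definition tropical_critical_solutions :: "nat \<Rightarrow> (nat \<Rightarrow> real) \<Rightarrow> (nat \<times> nat \<Rightarrow> real) set" where
  "tropical_critical_solutions n lam =
    {\<delta> \<in> verts (quiver n) \<rightarrow>\<^sub>E UNIV.
      (\<forall>i\<in>{1..n}. \<delta> (i, i) = lam i) \<and>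
      (\<forall>v\<in>dot_verts n.
        Min (tropical_coord n \<delta> ` in_arcs (quiver n) v) =
        Min (tropical_coord n \<delta> ` out_arcs (quiver n) v))}"

definition index_pairs :: "nat \<Rightarrow> (nat \<times> nat) set" where
  "index_pairs n = {(i, j). 1 \<le> i \<and> i < j \<and> j \<le> n}"

definition fillings :: "nat \<Rightarrow> (nat \<times> nat \<Rightarrow> real) set" where
  "fillings n = index_pairs n \<rightarrow>\<^sub>E {0..}"

definition ideal_filling :: "nat \<Rightarrow> (nat \<times> nat \<Rightarrow> real) \<Rightarrow> bool" where
  "ideal_filling n N \<longleftrightarrow> N \<in> fillings n \<and>
    (\<forall>(i, j)\<in>index_pairs n. j - i \<ge> 2 \<longrightarrow> N (i, j) = max (N (i + 1, j)) (N (i, j - 1)))"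

definition eps :: "nat \<Rightarrow> nat \<Rightarrow> real" where
  "eps i k = (if k = i then 1 else 0)"

definition alpha :: "nat \<Rightarrow> nat \<Rightarrow> nat \<Rightarrow> real" where
  "alpha i j k = eps i k - eps j k"

definition mean_weight :: "nat \<Rightarrow> (nat \<Rightarrow> real) \<Rightarrow> real" where
  "mean_weight n lam = 1 / real n * (\<Sum>i = 1..n. lam i)"

definition ideal_fillings_for :: "nat \<Rightarrow> (nat \<Rightarrow> real) \<Rightarrow> (nat \<times> nat \<Rightarrow> real) set" where
  "ideal_fillings_for n lam =
    {N. ideal_filling n N \<and>
      (\<forall>k\<in>{1..n}.
        (\<Sum>(i, j)\<in>index_pairs n. N (i, j) * alpha i j k) + mean_weight n lam * (\<Sum>i = 1..n. eps i k)
          = lam k)}"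

end

theory Submission
  imports Defs
begin

text \<open>
  The bijection sends a solution \<open>\<delta>\<close> to the common value \<open>m(i, j)\<close> of the two minima at each dot
  vertex. Since \<open>min x y + max x y = x + y\<close>, the sum of the conditions at \<open>(i, j)\<close> and
  \<open>(i - 1, j - 1)\<close> is linear in the labels of the square spanned by these vertices, and summing
  over squares gives
  \<open>\<delta>(i, j) = \<ell> + \<Sum>\<^bsub>s > i\<^esub> m(s, j) - \<Sum>\<^bsub>t < j\<^esub> m(i, t)\<close>.
  On the diagonal this is the weight equation, and off it, it is the inverse map. Nonnegativity is
  where dominance enters: from a vertex with \<open>m < 0\<close>, minimal arrows lead along decreasing labels
  to some \<open>(k, k)\<close> and backwards along increasing labels to some \<open>(l, l)\<close> with \<open>k < l\<close>.
\<close>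

section \<open>Critical labellings and the ideal condition for their minima\<close>

text \<open>Keeping \<open>m\<close> separate from \<open>d\<close> lets both the minima of a
  solution and the entries of a filling take its place. The case splits reflect missing arrows: none
  leaves column 1 to the left, none enters row \<open>n\<close> from below. The maximum comes from a
  minimum of differences with minuend \<open>d i j\<close>.\<close>

locale critical_labelling =
  fixes n :: nat and d m :: "nat \<Rightarrow> nat \<Rightarrow> real"
  assumes out_min: "\<And>i j. \<lbrakk>1 \<le> j; j < i; i \<le> n\<rbrakk> \<Longrightarrow>
      m i j = (if j = 1 then d (i - 1) j else min (d (i - 1) j) (d i (j - 1))) - d i j"
    and in_min: "\<And>i j. \<lbrakk>1 \<le> j; j < i; i \<le> n\<rbrakk> \<Longrightarrow>
      m i j = d i j - (if i = n then d i (j + 1) else max (d (i + 1) j) (d i (j + 1)))"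
begin

text \<open>
  A violation in column \<open>j\<close> forces one in column \<open>j - 1\<close>, which is impossible for \<open>j = 1\<close>. In the
  next lemma violations propagate downwards instead.
\<close>

lemma min_value_up_le:
  assumes "1 \<le> j" "j < i" "i < n"
  shows "m i j \<le> m (i + 1) j"
  using assms
proof (induction j rule: dec_induct)
  case base
  then show ?case
    using out_min[of 1 "i + 1"] in_min[of 1 i] by auto
next
  case (step j)
  then show ?case
    using out_min[of "Suc j" "i + 1"] in_min[of "Suc j" i] out_min[of "Suc j" i]
      in_min[of j i] in_min[of j "i + 1"]
    by (auto simp: min_def max_def split: if_splits)
qed

lemma min_value_right_le:
  assumes "1 \<le> j" "j + 1 < i" "i \<le> n"
  shows "m i (j + 1) \<le> m i j"
  using assms(3,1,2)
proof (induction i rule: inc_induct)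
  case base
  then show ?case
    using in_min[of j n] out_min[of "j + 1" n] by auto
next
  case (step i)
  then show ?case
    using in_min[of j i] out_min[of "j + 1" i] in_min[of "j + 1" i]
      out_min[of "j + 1" "Suc i"] out_min[of j "Suc i"]
    by (auto simp: min_def max_def split: if_splits)
qed

text \<open>The upper bound compares the two paths from \<open>(i, j + 1)\<close> to
  \<open>(i - 1, j)\<close> around a square. Either a neighbouring minimum is the coordinate of an
  arrow at \<open>(i, j)\<close>, or both lie on the other path and add up to the total of the path
  through \<open>(i, j)\<close>, which is at least \<open>2 * m i j\<close>.\<close>

lemma min_value_ideal:
  assumes "1 \<le> j" "j + 1 < i" "i \<le> n"
  shows "m i j = max (m i (j + 1)) (m (i - 1) j)"
proof -
  have "m i j \<le> d (i - 1) j - d i j"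
    using out_min[of j i] assms by auto
  moreover have "m i j \<le> d i j - d i (j + 1)"
    using in_min[of j i] assms by auto
  moreover have "m (i - 1) j = d (i - 1) j - d i j \<or> m (i - 1) j = d (i - 1) j - d (i - 1) (j + 1)"
    using in_min[of j "i - 1"] assms by (auto simp: max_def)
  moreover have "m i (j + 1) = d i j - d i (j + 1) \<or> m i (j + 1) = d (i - 1) (j + 1) - d i (j + 1)"
    using out_min[of "j + 1" i] assms by (auto simp: min_def)
  ultimately have "m i j \<le> max (m i (j + 1)) (m (i - 1) j)"
    by linarith
  then show ?thesis
    using min_value_up_le[of j "i - 1"] assms min_value_right_le[OF assms] by fastforce
qed

section \<open>Nonnegativity of the minima\<close>

text \<open>A minimal outgoing arrow with negative coordinate lowers the label and, being incoming
  at its head, makes the minimum there negative too. The walk goes up or left, so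
  \<open>i + j\<close> drops until a vertical arrow meets the diagonal.\<close>

lemma negative_reaches_smaller_star:
  assumes "1 \<le> j" "j < i" "i \<le> n" "m i j < 0"
  shows "\<exists>k. 1 \<le> k \<and> k \<le> j \<and> d k k < d i j"
  using assms
proof (induction "i + j" arbitrary: i j rule: less_induct)
  case less
  show ?case
  proof (cases "d (i - 1) j - d i j = m i j")
    case up: True
    show ?thesis
    proof (cases "j = i - 1")
      case True
      then show ?thesis using up less.prems by (intro exI[of _ j]) auto
    next
      case False
      then have "m (i - 1) j < 0"
        using up less.prems in_min[of j "i - 1"] by auto
      with False obtain k where "1 \<le> k" "k \<le> j" "d k k < d (i - 1) j"
        using less.hyps[of "i - 1" j] less.prems by fastforce
      then show ?thesis using up less.prems by (intro exI[of _ k]) auto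
    qed
  next
    case False
    then have j: "j \<noteq> 1" and left: "d i (j - 1) - d i j = m i j"
      using out_min[of j i] less.prems by (auto simp: min_def split: if_splits)
    then have "m i (j - 1) < 0"
      using less.prems in_min[of "j - 1" i] by auto
    with j obtain k where "1 \<le> k" "k \<le> j - 1" "d k k < d i (j - 1)"
      using less.hyps[of i "j - 1"] less.prems by fastforce
    then show ?thesis using left less.prems by (intro exI[of _ k]) auto
  qed
qed

text \<open>The same walk backwards along minimal incoming arrows: labels rise, and the walk goes
  down or right until a horizontal arrow starts at a star.\<close>

lemma negative_reached_from_larger_star:
  assumes "1 \<le> j" "j < i" "i \<le> n" "m i j < 0"
  shows "\<exists>k. i \<le> k \<and> k \<le> n \<and> d i j < d k k"
  using assms
proof (induction "2 * n - (i + j)" arbitrary: i j rule: less_induct)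
  case less
  show ?case
  proof (cases "d i j - d i (j + 1) = m i j")
    case right: True
    show ?thesis
    proof (cases "j + 1 = i")
      case True
      then show ?thesis using right less.prems by (intro exI[of _ i]) auto
    next
      case False
      then have "m i (j + 1) < 0"
        using right less.prems out_min[of "j + 1" i] by auto
      with False obtain k where "i \<le> k" "k \<le> n" "d i (j + 1) < d k k"
        using less.hyps[of i "j + 1"] less.prems by fastforce
      then show ?thesis using right less.prems by (intro exI[of _ k]) auto
    qed
  next
    case False
    then have i: "i \<noteq> n" and down: "d i j - d (i + 1) j = m i j"
      using in_min[of j i] less.prems by (auto simp: max_def split: if_splits)
    then have "m (i + 1) j < 0"
      using less.prems out_min[of j "i + 1"] by auto
    with i obtain k where "i + 1 \<le> k" "k \<le> n" "d (i + 1) j < d k k"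
      using less.hyps[of "i + 1" j] less.prems by fastforce
    then show ?thesis using down less.prems by (intro exI[of _ k]) auto
  qed
qed

lemma min_value_nonneg:
  assumes "dominant n (\<lambda>k. d k k)" "1 \<le> j" "j < i" "i \<le> n"
  shows "0 \<le> m i j"
proof (rule ccontr)
  assume "\<not> 0 \<le> m i j"
  then have neg: "m i j < 0" by simp
  obtain k where k: "1 \<le> k" "k \<le> j" "d k k < d i j"
    using negative_reaches_smaller_star[OF assms(2-4) neg] by blast
  obtain l where l: "i \<le> l" "l \<le> n" "d i j < d l l"
    using negative_reached_from_larger_star[OF assms(2-4) neg] by blast
  have "d l l \<le> d k k"
    using assms k l by (auto simp: dominant_def)
  then show False using k l by linarith
qed

section \<open>Labels as sums of minima\<close>

text \<open>The minimum in \<open>out_min\<close> at \<open>(i, j)\<close> and the maximum in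
  \<open>in_min\<close> at \<open>(i - 1, j - 1)\<close> are taken over the same two labels, at
  \<open>(i - 1, j)\<close> and \<open>(i, j - 1)\<close>.\<close>

lemma label_square:
  assumes "2 \<le> j" "j < i" "i \<le> n"
  shows "d (i - 1) j - d i j = d (i - 1) (j - 1) - d i (j - 1) + m i j - m (i - 1) (j - 1)"
  using assms out_min[of j i] in_min[of "j - 1" "i - 1"]
  by (auto simp: min_def max_def split: if_splits)

text \<open>Telescopes \<open>label_square\<close> along rows \<open>i - 1\<close> and
  \<open>i\<close>, starting in column 1, where the vertical arrow is the only outgoing one.\<close>

lemma label_vertical_difference:
  assumes "1 \<le> j" "j < i" "i \<le> n"
  shows "d (i - 1) j - d i j = (\<Sum>t = 1..j. m i t) - (\<Sum>t = 1..<j. m (i - 1) t)"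
  using assms
proof (induction j rule: dec_induct)
  case base
  then show ?case using out_min[of 1 i] by simp
next
  case (step j)
  then show ?case using label_square[of "Suc j" i] by (simp add: sum.atLeastLessThan_Suc)
qed

lemma label_bottom_row:
  assumes "1 \<le> j" "j \<le> n"
  shows "d n j = d n 1 - (\<Sum>t = 1..<j. m n t)"
  using assms
proof (induction j rule: dec_induct)
  case base
  then show ?case by simp
next
  case (step j)
  then show ?case using in_min[of j n] by (simp add: sum.atLeastLessThan_Suc)
qed

lemma label_eq:
  assumes "1 \<le> j" "j \<le> i" "i \<le> n"
  shows "d i j = d n 1 + (\<Sum>s\<in>{i<..n}. m s j) - (\<Sum>t = 1..<j. m i t)"
  using assms(3,1,2)
proof (induction i rule: inc_induct)
  case base
  then show ?case using label_bottom_row[of j] by simp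
next
  case (step i)
  have "{i<..n} = insert (Suc i) {Suc i<..n}"
    using step.hyps by auto
  \<comment> \<open>Only the term \<open>t = j\<close> survives; the others cancel against the row
    sum in the induction hypothesis.\<close>
  moreover have "(\<Sum>t = 1..j. m (Suc i) t) = (\<Sum>t = 1..<j. m (Suc i) t) + m (Suc i) j"
    using step.prems by (simp add: sum.last_plus atLeastLessThanSuc_atLeastAtMost[symmetric])
  ultimately show ?case
    using step label_vertical_difference[of j "Suc i"] by simp
qed

end

text \<open>Allows switching between extensional functions and unrestricted formulas, whose values
  may differ outside the triangle.\<close>

lemma critical_labelling_cong:
  assumes "critical_labelling n d m"
    and "\<And>i j. \<lbrakk>1 \<le> j; j \<le> i; i \<le> n\<rbrakk> \<Longrightarrow> d' i j = d i j"
    and "\<And>i j. \<lbrakk>1 \<le> j; j < i; i \<le> n\<rbrakk> \<Longrightarrow> m' i j = m i j"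
  shows "critical_labelling n d' m'"
proof
  fix i j assume ij: "1 \<le> j" "j < i" "i \<le> n"
  \<comment> \<open>Column 0 lies outside the triangle, hence the guard on \<open>j\<close>; the
    guard on \<open>i\<close> below excludes row \<open>n + 1\<close>.\<close>
  have "d' (i - 1) j = d (i - 1) j" and "j \<noteq> 1 \<Longrightarrow> d' i (j - 1) = d i (j - 1)"
    using ij by (intro assms(2); linarith)+
  then show "m' i j = (if j = 1 then d' (i - 1) j else min (d' (i - 1) j) (d' i (j - 1))) - d' i j"
    using critical_labelling.out_min[OF assms(1) ij] assms(2,3) ij by simp
  have "i \<noteq> n \<Longrightarrow> d' (i + 1) j = d (i + 1) j" and "d' i (j + 1) = d i (j + 1)"
    using ij by (intro assms(2); linarith)+
  then show "m' i j = d' i j - (if i = n then d' i (j + 1) else max (d' (i + 1) j) (d' i (j + 1)))"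
    using critical_labelling.in_min[OF assms(1) ij] assms(2,3) ij by simp
qed

section \<open>The critical labelling of an ideal array\<close>

text \<open>The ideal condition for a filling \<open>N\<close>, transposed to
  \<open>m i j = N (j, i)\<close> so that indices match dot vertices.\<close>

locale ideal_array =
  fixes n :: nat and m :: "nat \<Rightarrow> nat \<Rightarrow> real"
  assumes ideal: "\<And>i j. \<lbrakk>1 \<le> j; j + 1 < i; i \<le> n\<rbrakk> \<Longrightarrow> m i j = max (m i (j + 1)) (m (i - 1) j)"
begin

text \<open>The right-hand side of \<open>label_eq\<close>, with \<open>l\<close> for the corner
  label \<open>d n 1\<close>.\<close>

definition label :: "real \<Rightarrow> nat \<Rightarrow> nat \<Rightarrow> real" where
  "label l i j = l + (\<Sum>s\<in>{i<..n}. m s j) - (\<Sum>t = 1..<j. m i t)"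

lemma up_le:
  assumes "1 \<le> j" "j < i" "i < n"
  shows "m i j \<le> m (i + 1) j"
  using assms ideal[of j "i + 1"] by simp

lemma right_le:
  assumes "1 \<le> j" "j + 1 < i" "i \<le> n"
  shows "m i (j + 1) \<le> m i j"
  using assms ideal[of j i] by simp

text \<open>Going left, the maximum at \<open>(i + 1, t)\<close> is between
  \<open>m i (t + 1)\<close> and \<open>m i t\<close>, and \<open>right_le\<close> selects the
  latter. This makes the correction sum in \<open>label_vertical\<close> vanish.\<close>

lemma rows_agree:
  assumes "m (i + 1) j = m i j" "1 \<le> j" "j < i" "i < n" "1 \<le> t" "t \<le> j"
  shows "m (i + 1) t = m i t"
  using assms(6,5)
proof (induction t rule: inc_induct)
  case base
  then show ?case using assms by simp
next
  case (step t)
  then show ?case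
    using assms ideal[of t "i + 1"] right_le[of t i] by simp
qed

text \<open>The counterpart of \<open>rows_agree\<close> for \<open>label_horizontal\<close>, with
  \<open>up_le\<close> deciding the maximum.\<close>

lemma columns_agree:
  assumes "m i j = m i (j + 1)" "1 \<le> j" "j + 1 < i" "i \<le> s" "s \<le> n"
  shows "m s j = m s (j + 1)"
  using assms(4,5)
proof (induction s rule: dec_induct)
  case base
  then show ?case using assms by simp
next
  case (step s)
  then show ?case
    using assms ideal[of j "Suc s"] up_le[of "j + 1" s] by simp
qed

text \<open>Writes an arrow coordinate as an entry plus a correction sum. The corrections here and
  in \<open>label_horizontal\<close> are nonnegative term by term, by monotonicity.\<close>

lemma label_vertical:
  assumes "1 \<le> j" "j \<le> i" "i < n"
  shows "label l i j - label l (i + 1) j = m (i + 1) j + (\<Sum>t = 1..<j. m (i + 1) t - m i t)"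
proof -
  have "{i<..n} = insert (i + 1) {i + 1<..n}"
    using assms by auto
  then show ?thesis by (simp add: label_def sum_subtractf)
qed

lemma label_horizontal:
  assumes "1 \<le> j" "j < i" "i \<le> n"
  shows "label l i j - label l i (j + 1) = m i j + (\<Sum>s\<in>{i<..n}. m s j - m s (j + 1))"
  using assms by (simp add: label_def sum_subtractf)

lemma rows_sum_nonneg:
  assumes "j \<le> i" "i < n"
  shows "0 \<le> (\<Sum>t = 1..<j. m (i + 1) t - m i t)"
  using assms up_le by (intro sum_nonneg) auto

lemma columns_sum_nonneg:
  assumes "1 \<le> j" "j < i" "i \<le> n"
  shows "0 \<le> (\<Sum>s\<in>{i<..n}. m s j - m s (j + 1))"
  using assms right_le by (intro sum_nonneg) auto

lemma label_vertical_eq: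
  assumes "m (i + 1) j = m i j" "1 \<le> j" "j < i" "i < n"
  shows "label l i j - label l (i + 1) j = m i j"
  using label_vertical[of j i l] rows_agree[of i j] assms by simp

lemma label_horizontal_eq:
  assumes "m i j = m i (j + 1)" "1 \<le> j" "j + 1 < i" "i \<le> n"
  shows "label l i j - label l i (j + 1) = m i j"
  using label_horizontal[of j i l] columns_agree[of i j] assms by simp

lemma label_out_min:
  assumes "1 \<le> j" "j < i" "i \<le> n"
  shows "m i j = (if j = 1 then label l (i - 1) j else min (label l (i - 1) j) (label l i (j - 1)))
                   - label l i j"
proof (cases "j = 1")
  case True
  then show ?thesis using label_vertical[of j "i - 1" l] assms by simp
next
  case False
  have up: "label l (i - 1) j - label l i j = m i j + (\<Sum>t = 1..<j. m i t - m (i - 1) t)"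
    using label_vertical[of j "i - 1" l] assms by simp
  have up_ge: "m i j \<le> label l (i - 1) j - label l i j"
    using rows_sum_nonneg[of j "i - 1"] up assms by simp
  have left_ge: "m i j \<le> label l i (j - 1) - label l i j"
    using label_horizontal[of "j - 1" i l] columns_sum_nonneg[of "j - 1" i]
      right_le[of "j - 1" i] False assms by fastforce
  \<comment> \<open>The ideal condition at \<open>(i, j - 1)\<close> decides which bound is sharp:
    the horizontal one if \<open>m i j\<close> attains the maximum, the vertical one if
    \<open>m (i - 1) (j - 1)\<close> does.\<close>
  have "m i (j - 1) = m i j \<or> m i (j - 1) = m (i - 1) (j - 1)"
    using ideal[of "j - 1" i] False assms by (simp add: max_def)
  then have "label l i (j - 1) - label l i j = m i j \<or> label l (i - 1) j - label l i j = m i j"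
  proof
    assume "m i (j - 1) = m i j"
    then show ?thesis
      using label_horizontal_eq[of i "j - 1" l] False assms by simp
  next
    assume "m i (j - 1) = m (i - 1) (j - 1)"
    then have "m i t = m (i - 1) t" if "1 \<le> t" "t < j" for t
      using rows_agree[of "i - 1" "j - 1" t] that False assms by simp
    then show ?thesis using up by simp
  qed
  then show ?thesis using up_ge left_ge False by (auto simp: min_def)
qed

lemma label_in_min:
  assumes "1 \<le> j" "j < i" "i \<le> n"
  shows "m i j = label l i j - (if i = n then label l i (j + 1)
                                else max (label l (i + 1) j) (label l i (j + 1)))"
proof (cases "i = n")
  case True
  then show ?thesis using label_horizontal[of j i l] assms by simp
next
  case False
  have right_ge: "m i j \<le> label l i j - label l i (j + 1)"
    using label_horizontal[of j i l] columns_sum_nonneg[of j i] assms by simp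
  have down_ge: "m i j \<le> label l i j - label l (i + 1) j"
    using label_vertical[of j i l] rows_sum_nonneg[of j i] up_le[of j i] False assms by simp
  \<comment> \<open>For incoming arrows the ideal condition at \<open>(i + 1, j)\<close> decides:
    the vertical bound is sharp if \<open>m i j\<close> attains the maximum, the horizontal one
    otherwise.\<close>
  have "m (i + 1) j = m i j \<or> m (i + 1) j = m (i + 1) (j + 1)"
    using ideal[of j "i + 1"] False assms by (simp add: max_def)
  then have "label l i j - label l (i + 1) j = m i j \<or> label l i j - label l i (j + 1) = m i j"
  proof
    assume "m (i + 1) j = m i j"
    then show ?thesis
      using label_vertical_eq[of i j l] False assms by simp
  next
    assume "m (i + 1) j = m (i + 1) (j + 1)"
    then have "m s j = m s (j + 1)" if "i < s" "s \<le> n" for s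
      using columns_agree[of "i + 1" j s] that assms by simp
    then show ?thesis using label_horizontal[of j i l] assms by simp
  qed
  then show ?thesis using right_ge down_ge False by (auto simp: max_def)
qed

lemma critical_labelling_label: "critical_labelling n (label l) m"
  using label_out_min label_in_min by unfold_locales

end

section \<open>Quiver minima and critical labellings\<close>

lemma Min_out_arcs:
  assumes "1 \<le> j" "j < i" "i \<le> n"
  shows "Min (tropical_coord n \<delta> ` out_arcs (quiver n) (i, j)) =
    (if j = 1 then \<delta> (i - 1, j) else min (\<delta> (i - 1, j)) (\<delta> (i, j - 1))) - \<delta> (i, j)"
proof -
  have "out_arcs (quiver n) (i, j) =
      (if j = 1 then {Vert (i - 1) j} else {Vert (i - 1) j, Horiz i j})"
    using assms by (auto simp: out_arcs_def quiver_def)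
  then show ?thesis
    using assms by (auto simp: tropical_coord_def quiver_def min_def)
qed

lemma Min_in_arcs:
  assumes "1 \<le> j" "j < i" "i \<le> n"
  shows "Min (tropical_coord n \<delta> ` in_arcs (quiver n) (i, j)) =
    \<delta> (i, j) - (if i = n then \<delta> (i, j + 1) else max (\<delta> (i + 1, j)) (\<delta> (i, j + 1)))"
proof -
  have "in_arcs (quiver n) (i, j) =
      (if i = n then {Horiz i (j + 1)} else {Vert i j, Horiz i (j + 1)})"
    using assms by (auto simp: in_arcs_def quiver_def)
  then show ?thesis
    using assms by (auto simp: tropical_coord_def quiver_def min_def max_def)
qed

text \<open>With \<open>m\<close> taken to be the outgoing minima, \<open>out_min\<close> holds by
  \<open>Min_out_arcs\<close>, and \<open>in_min\<close> is the critical condition.\<close>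

lemma mem_tropical_critical_solutions_iff:
  "\<delta> \<in> tropical_critical_solutions n lam \<longleftrightarrow>
    \<delta> \<in> verts (quiver n) \<rightarrow>\<^sub>E UNIV \<and> (\<forall>i\<in>{1..n}. \<delta> (i, i) = lam i) \<and>
    critical_labelling n (\<lambda>i j. \<delta> (i, j))
      (\<lambda>i j. Min (tropical_coord n \<delta> ` out_arcs (quiver n) (i, j)))"
proof -
  have "(\<forall>v\<in>dot_verts n. Min (tropical_coord n \<delta> ` in_arcs (quiver n) v) =
      Min (tropical_coord n \<delta> ` out_arcs (quiver n) v)) \<longleftrightarrow>
    critical_labelling n (\<lambda>i j. \<delta> (i, j))
      (\<lambda>i j. Min (tropical_coord n \<delta> ` out_arcs (quiver n) (i, j)))"
    (is "?crit \<longleftrightarrow> critical_labelling n ?d ?m")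
  proof
    assume crit: ?crit
    show "critical_labelling n ?d ?m"
    proof
      fix i j assume ij: "1 \<le> j" "j < i" "i \<le> n"
      then have "?m i j = Min (tropical_coord n \<delta> ` in_arcs (quiver n) (i, j))"
        using crit by (simp add: dot_verts_def)
      then show "?m i j = ?d i j - (if i = n then ?d i (j + 1) else max (?d (i + 1) j) (?d i (j + 1)))"
        using Min_in_arcs[OF ij] by simp
    qed (rule Min_out_arcs)
  next
    assume "critical_labelling n ?d ?m"
    then show ?crit
      using critical_labelling.in_min[of n ?d ?m] Min_in_arcs[of _ _ n \<delta>]
      by (simp add: dot_verts_def)
  qed
  then show ?thesis
    by (simp add: tropical_critical_solutions_def)
qed

section \<open>The weight equation\<close>

lemma finite_index_pairs: "finite (index_pairs n)"
  by (rule finite_subset[of _ "{..n} \<times> {..n}"]) (auto simp: index_pairs_def)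

text \<open>Up to the constant, this is the diagonal case of the label formula in transposed
  indices, so prescribing the star labels amounts to the weight equation.\<close>

lemma sum_alpha:
  fixes N :: "nat \<times> nat \<Rightarrow> real"
  assumes "k \<in> {1..n}"
  shows "(\<Sum>(i, j)\<in>index_pairs n. N (i, j) * alpha i j k) =
    (\<Sum>s\<in>{k<..n}. N (k, s)) - (\<Sum>t = 1..<k. N (t, k))"
proof -
  have "(\<Sum>(i, j)\<in>index_pairs n. N (i, j) * alpha i j k) =
      (\<Sum>p\<in>index_pairs n. if fst p = k then N p else 0) -
      (\<Sum>p\<in>index_pairs n. if snd p = k then N p else 0)"
    unfolding sum_subtractf[symmetric]
    by (rule sum.cong) (auto simp: alpha_def eps_def)
  also have "(\<Sum>p\<in>index_pairs n. if fst p = k then N p else 0) =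
      (\<Sum>p\<in>{p \<in> index_pairs n. fst p = k}. N p)"
    by (simp add: sum.inter_filter finite_index_pairs)
  also have "{p \<in> index_pairs n. fst p = k} = Pair k ` {k<..n}"
    using assms by (auto simp: index_pairs_def)
  also have "(\<Sum>p\<in>Pair k ` {k<..n}. N p) = (\<Sum>s\<in>{k<..n}. N (k, s))"
    by (simp add: sum.reindex inj_on_def)
  also have "(\<Sum>p\<in>index_pairs n. if snd p = k then N p else 0) =
      (\<Sum>p\<in>{p \<in> index_pairs n. snd p = k}. N p)"
    by (simp add: sum.inter_filter finite_index_pairs)
  also have "{p \<in> index_pairs n. snd p = k} = (\<lambda>t. (t, k)) ` {1..<k}"
    using assms by (auto simp: index_pairs_def)
  also have "(\<Sum>p\<in>(\<lambda>t. (t, k)) ` {1..<k}. N p) = (\<Sum>t = 1..<k. N (t, k))"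
    by (simp add: sum.reindex inj_on_def)
  finally show ?thesis .
qed

lemma sum_sum_alpha:
  fixes N :: "nat \<times> nat \<Rightarrow> real"
  shows "(\<Sum>k = 1..n. \<Sum>(i, j)\<in>index_pairs n. N (i, j) * alpha i j k) = 0"
proof -
  have "(\<Sum>k = 1..n. case p of (i, j) \<Rightarrow> N (i, j) * alpha i j k) = 0"
    if "p \<in> index_pairs n" for p
    using that by (auto simp: alpha_def eps_def sum_distrib_left[symmetric] sum_subtractf
        index_pairs_def)
  then show ?thesis
    by (subst sum.swap) (rule sum.neutral, blast)
qed

lemma mem_ideal_fillings_for_iff:
  "N \<in> ideal_fillings_for n lam \<longleftrightarrow> ideal_filling n N \<and>
    (\<forall>k\<in>{1..n}. (\<Sum>(i, j)\<in>index_pairs n. N (i, j) * alpha i j k) + mean_weight n lam = lam k)"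
  by (simp add: ideal_fillings_for_def eps_def)

text \<open>The pair \<open>(i, j)\<close> with \<open>i < j\<close> corresponds to the dot vertex $v_{ji}$.\<close>

definition min_filling :: "nat \<Rightarrow> (nat \<times> nat \<Rightarrow> real) \<Rightarrow> nat \<times> nat \<Rightarrow> real" where
  "min_filling n \<delta> = (\<lambda>(i, j)\<in>index_pairs n.
     Min (tropical_coord n \<delta> ` out_arcs (quiver n) (j, i)))"

text \<open>This is \<open>label\<close> for the array \<open>m i j = N (j, i)\<close>, restricted
  to the vertices.\<close>

definition filling_labels :: "nat \<Rightarrow> real \<Rightarrow> (nat \<times> nat \<Rightarrow> real) \<Rightarrow> nat \<times> nat \<Rightarrow> real" where
  "filling_labels n l N = (\<lambda>(i, j)\<in>verts (quiver n).
     l + (\<Sum>s\<in>{i<..n}. N (j, s)) - (\<Sum>t = 1..<j. N (t, i)))"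

section \<open>From solutions to ideal fillings\<close>

lemma critical_labelling_min_filling:
  assumes "\<delta> \<in> tropical_critical_solutions n lam"
  shows "critical_labelling n (\<lambda>i j. \<delta> (i, j)) (\<lambda>i j. min_filling n \<delta> (j, i))"
  by (rule critical_labelling_cong[of n "\<lambda>i j. \<delta> (i, j)"
        "\<lambda>i j. Min (tropical_coord n \<delta> ` out_arcs (quiver n) (i, j))"])
    (use assms in \<open>auto simp: mem_tropical_critical_solutions_iff min_filling_def index_pairs_def\<close>)

lemma solution_label_eq:
  assumes "\<delta> \<in> tropical_critical_solutions n lam" "1 \<le> j" "j \<le> i" "i \<le> n"
  shows "\<delta> (i, j) = \<delta> (n, 1) + (\<Sum>s\<in>{i<..n}. min_filling n \<delta> (j, s))
                      - (\<Sum>t = 1..<j. min_filling n \<delta> (t, i))"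
  by (rule critical_labelling.label_eq[OF critical_labelling_min_filling[OF assms(1)] assms(2-4)])

lemma solution_weight:
  assumes "\<delta> \<in> tropical_critical_solutions n lam" "k \<in> {1..n}"
  shows "lam k = \<delta> (n, 1) + (\<Sum>(i, j)\<in>index_pairs n. min_filling n \<delta> (i, j) * alpha i j k)"
proof -
  have "lam k = \<delta> (k, k)"
    using assms by (simp add: tropical_critical_solutions_def)
  then show ?thesis
    using solution_label_eq[OF assms(1), of k k] assms(2) sum_alpha[OF assms(2)] by simp
qed

text \<open>Summing the weight equation over \<open>k\<close> cancels all roots and leaves
  \<open>n\<close> copies of the corner label.\<close>

lemma solution_corner:
  assumes "\<delta> \<in> tropical_critical_solutions n lam" "n \<ge> 1"
  shows "\<delta> (n, 1) = mean_weight n lam"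
proof -
  have "(\<Sum>k = 1..n. lam k) = (\<Sum>k = 1..n.
      \<delta> (n, 1) + (\<Sum>(i, j)\<in>index_pairs n. min_filling n \<delta> (i, j) * alpha i j k))"
    by (rule sum.cong[OF refl solution_weight[OF assms(1)]])
  also have "\<dots> = real n * \<delta> (n, 1)"
    by (simp add: sum.distrib sum_sum_alpha[of "min_filling n \<delta>" n, simplified])
  finally show ?thesis
    using assms(2) by (simp add: mean_weight_def)
qed

lemma min_filling_in_ideal_fillings_for:
  assumes "\<delta> \<in> tropical_critical_solutions n lam" "n \<ge> 1" "dominant n lam"
  shows "min_filling n \<delta> \<in> ideal_fillings_for n lam"
proof -
  interpret critical_labelling n "\<lambda>i j. \<delta> (i, j)" "\<lambda>i j. min_filling n \<delta> (j, i)"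
    by (rule critical_labelling_min_filling[OF assms(1)])
  have "dominant n (\<lambda>k. \<delta> (k, k))"
    using assms(1,3) by (simp add: dominant_def tropical_critical_solutions_def)
  \<comment> \<open>The column is instantiated first in \<open>min_value_nonneg[of i j]\<close>, so
    it concerns the dot vertex \<open>(j, i)\<close>.\<close>
  then have "0 \<le> min_filling n \<delta> (i, j)" if "(i, j) \<in> index_pairs n" for i j
    using that min_value_nonneg[of i j] by (simp add: index_pairs_def)
  then have "min_filling n \<delta> \<in> fillings n"
    by (auto simp: fillings_def min_filling_def)
  moreover have "min_filling n \<delta> (i, j) =
      max (min_filling n \<delta> (i + 1, j)) (min_filling n \<delta> (i, j - 1))"
    if "(i, j) \<in> index_pairs n" "j - i \<ge> 2" for i j
    using that min_value_ideal[of i j] by (simp add: index_pairs_def)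
  ultimately have "ideal_filling n (min_filling n \<delta>)"
    by (auto simp: ideal_filling_def)
  then show ?thesis
    using solution_weight[OF assms(1)] solution_corner[OF assms(1,2)]
    by (simp add: mem_ideal_fillings_for_iff)
qed

lemma filling_labels_min_filling:
  assumes "\<delta> \<in> tropical_critical_solutions n lam" "n \<ge> 1"
  shows "filling_labels n (mean_weight n lam) (min_filling n \<delta>) = \<delta>"
proof (rule extensionalityI[of _ "verts (quiver n)"])
  show "\<delta> \<in> extensional (verts (quiver n))"
    using assms(1) by (auto simp: tropical_critical_solutions_def PiE_def)
  show "filling_labels n (mean_weight n lam) (min_filling n \<delta>) v = \<delta> v"
    if "v \<in> verts (quiver n)" for v
    using that solution_label_eq[OF assms(1)] solution_corner[OF assms]
    by (auto simp: filling_labels_def quiver_def)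
qed (simp add: filling_labels_def)

section \<open>From ideal fillings to solutions\<close>

context
  fixes n :: nat and lam :: "nat \<Rightarrow> real" and N :: "nat \<times> nat \<Rightarrow> real"
  assumes N: "N \<in> ideal_fillings_for n lam"
begin

lemma critical_labelling_filling_labels:
  "critical_labelling n (\<lambda>i j. filling_labels n (mean_weight n lam) N (i, j)) (\<lambda>i j. N (j, i))"
proof -
  interpret ideal_array n "\<lambda>i j. N (j, i)"
    using N by unfold_locales (fastforce simp: ideal_fillings_for_def ideal_filling_def index_pairs_def)
  have "filling_labels n (mean_weight n lam) N (i, j) = label (mean_weight n lam) i j"
    if "1 \<le> j" "j \<le> i" "i \<le> n" for i j
    using that by (simp add: filling_labels_def label_def quiver_def)
  then show ?thesis
    by (rule critical_labelling_cong[OF critical_labelling_label]) simp_all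
qed

text \<open>Both sides have the same expression, by \<open>Min_out_arcs\<close> and
  \<open>out_min\<close>. Hence \<open>min_filling\<close> undoes
  \<open>filling_labels\<close>.\<close>

lemma min_out_filling_labels:
  assumes "1 \<le> j" "j < i" "i \<le> n"
  shows "Min (tropical_coord n (filling_labels n (mean_weight n lam) N) ` out_arcs (quiver n) (i, j))
    = N (j, i)"
  using critical_labelling.out_min[OF critical_labelling_filling_labels assms] Min_out_arcs[OF assms]
  by simp

lemma filling_labels_in_tropical_critical_solutions:
  "filling_labels n (mean_weight n lam) N \<in> tropical_critical_solutions n lam"
proof -
  have "filling_labels n (mean_weight n lam) N (k, k) = lam k" if "k \<in> {1..n}" for k
  proof -
    have "(\<Sum>(i, j)\<in>index_pairs n. N (i, j) * alpha i j k) + mean_weight n lam = lam k"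
      using N that by (simp add: mem_ideal_fillings_for_iff)
    then show ?thesis
      using that sum_alpha[OF that, of N] by (simp add: filling_labels_def quiver_def)
  qed
  moreover have "filling_labels n (mean_weight n lam) N \<in> verts (quiver n) \<rightarrow>\<^sub>E UNIV"
    by (simp add: filling_labels_def)
  moreover have "critical_labelling n (\<lambda>i j. filling_labels n (mean_weight n lam) N (i, j))
      (\<lambda>i j. Min (tropical_coord n (filling_labels n (mean_weight n lam) N)
        ` out_arcs (quiver n) (i, j)))"
    \<comment> \<open>The entries of \<open>N\<close> are exchanged for the outgoing minima they
      equal.\<close>
    by (rule critical_labelling_cong[OF critical_labelling_filling_labels])
      (simp_all add: min_out_filling_labels)
  ultimately show ?thesis
    by (simp add: mem_tropical_critical_solutions_iff)
qed

lemma min_filling_filling_labels: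
  "min_filling n (filling_labels n (mean_weight n lam) N) = N"
proof (rule extensionalityI[of _ "index_pairs n"])
  show "N \<in> extensional (index_pairs n)"
    using N by (auto simp: ideal_fillings_for_def ideal_filling_def fillings_def PiE_def)
  show "min_filling n (filling_labels n (mean_weight n lam) N) p = N p"
    if "p \<in> index_pairs n" for p
    using that min_out_filling_labels by (auto simp: min_filling_def index_pairs_def)
qed (simp add: min_filling_def)

end

theorem proposition5p4p3:
  fixes n :: nat and lam :: "nat \<Rightarrow> real"
  assumes "n \<ge> 1" and "dominant n lam"
  shows "\<exists>\<Phi>. bij_betw \<Phi> (tropical_critical_solutions n lam) (ideal_fillings_for n lam)"
proof -
  have "bij_betw (min_filling n) (tropical_critical_solutions n lam) (ideal_fillings_for n lam)"
    using assms
    by (intro bij_betw_byWitness[where f' = "filling_labels n (mean_weight n lam)"])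
      (auto simp: filling_labels_min_filling min_filling_filling_labels
        min_filling_in_ideal_fillings_for filling_labels_in_tropical_critical_solutions)
  then show ?thesis by blast
qed

end
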